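(* Let $D$ be a finite simple digraph. Then: (1) The following are equivalent: (i) $\Pi(D)=\{0\}$; (ii) $\#\Pi(D)=1$; (iii) $D$ is acyclic. (2) The following are equivalent: (i) $\Pi(D)=\{0,1\}$; (ii) $\#\Pi(D)=2$; (iii) $D$ is not acyclic and each subdigraph induced by a strongly connected component of $D$ is either a directed cycle or a single isolated vertex.
   Context: A simple digraph has no loops and no multiple arcs. For a real matrix $A\in\mathcal{M}_n(\mathbb{R})$, $\lambda\in\mathbb{R}$ is a complementarity eigenvalue if there is a nonzero $x\geq\mathbf{o}$ with $Ax\geq\lambda x$ and $\langle x,Ax-\lambda x\rangle=0$; the set of these is $\Pi(A)$. The complementarity spectrum of a digraph $D$ is $\Pi(D):=\Pi(A(D))$, where $A(D)$ is its $0/1$ adjacency matrix ($a_{ij}=1$ iff $(i,j)$ is an arc). $\#S$ denotes cardinality. Acyclic means containing no directed cycle. *)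

theory Defs
  imports "Graph_Theory.Digraph_Component" "Jordan_Normal_Form.Matrix"
begin

definition complementarity_eigenvalue :: "real mat \<Rightarrow> real \<Rightarrow> bool" where
  "complementarity_eigenvalue A l \<longleftrightarrow>
     (\<exists>x \<in> carrier_vec (dim_row A).
        x \<noteq> 0\<^sub>v (dim_row A) \<and> 0\<^sub>v (dim_row A) \<le> x \<and>
        l \<cdot>\<^sub>v x \<le> A *\<^sub>v x \<and>
        x \<bullet> (A *\<^sub>v x - l \<cdot>\<^sub>v x) = 0)"

definition complementarity_spectrum :: "real mat \<Rightarrow> real set" where
  "complementarity_spectrum A = {l. complementarity_eigenvalue A l}"

(* The adjacency matrix depends on a numbering of the vertices, given here by a list vs;
   it is meant for distinct vs with set vs = verts D. *)
definition adjacency_matrix :: "('a, 'b) pre_digraph \<Rightarrow> 'a list \<Rightarrow> real mat" where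
  "adjacency_matrix D vs =
     mat (length vs) (length vs) (\<lambda>(i, j). if vs ! i \<rightarrow>\<^bsub>D\<^esub> vs ! j then 1 else 0)"

definition digraph_spectrum :: "('a, 'b) pre_digraph \<Rightarrow> 'a list \<Rightarrow> real set" where
  "digraph_spectrum D vs = complementarity_spectrum (adjacency_matrix D vs)"

definition acyclic_digraph :: "('a, 'b) pre_digraph \<Rightarrow> bool" where
  "acyclic_digraph D \<longleftrightarrow> \<not> (\<exists>p. pre_digraph.cycle D p)"

(* The whole digraph is one directed cycle: a cycle p uses all arcs and all vertices.
   Length 2 (a pair of opposite arcs) is allowed. *)
definition is_directed_cycle :: "('a, 'b) pre_digraph \<Rightarrow> bool" where
  "is_directed_cycle H \<longleftrightarrow>
     (\<exists>p. pre_digraph.cycle H p \<and> arcs H = set p \<and> verts H = tail H ` set p)"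

definition is_single_isolated_vertex :: "('a, 'b) pre_digraph \<Rightarrow> bool" where
  "is_single_isolated_vertex H \<longleftrightarrow> (\<exists>v. verts H = {v}) \<and> arcs H = {}"

end

theory Submission
  imports Defs "HOL-Analysis.Function_Topology"
begin

text \<open>
  The vector supported at a single vertex shows that 0 is always in the spectrum, and the support
  of a vector for a positive eigenvalue is a set in which every vertex has a successor, so it
  contains a directed cycle. Conversely, in a minimal such set every vertex has exactly one
  successor, and its indicator vector gives the eigenvalue 1.

  If all strong components are trivial, restrict a vector for l > 0 to a terminal strong class of
  its support: there the successor map is a bijection f with x (f v) = l * x v, and summation gives
  l = 1. If some strong component H is nontrivial, let l be the largest number for which
  A(H) x \<ge> l x has a nonzero solution x \<ge> 0. Then l \<ge> 1 is an eigenvalue with an eigenvector that,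
  extended by zero, is a complementarity eigenvector of the whole digraph; and if l = 1, the
  eigenvector does not increase along arcs, hence is constant, all out-degrees in H are 1, and H is
  a directed cycle.
\<close>

section \<open>Maximal growth factors and Perron eigenvectors\<close>

definition subinvariant :: "'a set \<Rightarrow> ('a \<times> 'a) set \<Rightarrow> real \<Rightarrow> ('a \<Rightarrow> real) \<Rightarrow> bool" where
  "subinvariant V E l x \<longleftrightarrow>
     (\<forall>v\<in>V. 0 \<le> x v) \<and> (\<exists>v\<in>V. x v \<noteq> 0) \<and> (\<forall>v\<in>V. l * x v \<le> sum x (E `` {v}))"

lemma subinvariant_sum_pos:
  assumes "finite V" "subinvariant V E l x"
  shows "0 < sum x V"
proof -
  obtain v where "v \<in> V" "x v \<noteq> 0" using assms by (auto simp: subinvariant_def)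
  moreover have "0 \<le> x v" using assms calculation by (auto simp: subinvariant_def)
  ultimately show ?thesis
    using assms by (intro sum_pos2[of V v]) (auto simp: subinvariant_def)
qed

text \<open>Summing the inequalities over V suffices, since every successor sum is at most the total
  of x. The bound confines l to a compact interval.\<close>

lemma subinvariant_le_card:
  assumes "finite V" "E \<subseteq> V \<times> V" "subinvariant V E l x"
  shows "l \<le> real (card V)"
proof -
  have "l * sum x V = (\<Sum>v\<in>V. l * x v)" by (simp add: sum_distrib_left)
  also have "\<dots> \<le> (\<Sum>v\<in>V. sum x (E `` {v}))"
    using assms by (intro sum_mono) (auto simp: subinvariant_def)
  also have "\<dots> \<le> (\<Sum>v\<in>V. sum x V)"
    using assms by (intro sum_mono sum_mono2) (auto simp: subinvariant_def)
  also have "\<dots> = real (card V) * sum x V" by simp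
  finally show ?thesis using subinvariant_sum_pos[OF assms(1,3)] by simp
qed

text \<open>Here l varies together with x, so maximising l means maximising a coordinate on a closed
  set. The normalisation keeps limits away from the zero vector.\<close>

lemma closed_subinvariant:
  "closed {p :: real \<times> ('a \<Rightarrow> real). sum (snd p) V = 1 \<and>
     (\<forall>v\<in>V. fst p * snd p v \<le> sum (snd p) (E `` {v}))}"
proof -
  have c: "continuous_on UNIV (\<lambda>p :: real \<times> ('a \<Rightarrow> real). snd p v)" for v
    by (intro continuous_on_product_then_coordinatewise[OF continuous_on_snd[OF continuous_on_id]])
  have "{p :: real \<times> ('a \<Rightarrow> real). sum (snd p) V = 1 \<and>
     (\<forall>v\<in>V. fst p * snd p v \<le> sum (snd p) (E `` {v}))} = 
     {p. sum (snd p) V = 1} \<inter> (\<Inter>v\<in>V. {p. fst p * snd p v \<le> sum (snd p) (E `` {v})})"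
    by auto
  also have "closed \<dots>"
    by (intro closed_Int closed_INT ballI closed_Collect_eq closed_Collect_le continuous_intros c)
  finally show ?thesis .
qed

text \<open>The normalised pairs (l, x) with l \<ge> 1 form a compact set, on which l attains its
  maximum. The set is nonempty because the constant vector 1 is subinvariant with l = 1 as soon as
  every vertex has a successor.\<close>

lemma maximal_subinvariant_exists:
  assumes "finite V" "V \<noteq> {}" "E \<subseteq> V \<times> V" "\<And>v. v \<in> V \<Longrightarrow> E `` {v} \<noteq> {}"
  obtains l x where "1 \<le> l" "subinvariant V E l x"
    "\<And>l' x'. subinvariant V E l' x' \<Longrightarrow> l' \<le> l"
proof -
  \<comment> \<open>Coordinates outside V are pinned to 0, so K is a product of compact sets over
    the whole type and Tychonoff's theorem applies.\<close>
  define K :: "('a \<Rightarrow> real) set" where "K = PiE UNIV (\<lambda>v. if v \<in> V then {0..1} else {0})"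
  have "compactin (product_topology (\<lambda>_. euclidean) UNIV) K"
    unfolding K_def by (subst compactin_PiE) auto
  then have "compact K" by (simp add: euclidean_product_topology)
  define C where "C = ({1..real (card V)} \<times> K) \<inter> {p. sum (snd p) V = 1 \<and>
     (\<forall>v\<in>V. fst p * snd p v \<le> sum (snd p) (E `` {v}))}"
  have "compact C"
    unfolding C_def using \<open>compact K\<close>
    by (intro compact_Int_closed compact_Times closed_subinvariant) auto
  \<comment> \<open>Subinvariance is homogeneous and only looks at values on V, so dividing by the
    total and cutting off outside V leads into C.\<close>
  have normalised: "\<exists>y. (l, y) \<in> C" if "subinvariant V E l x" "1 \<le> l" for l x
  proof -
    define s where "s = sum x V"
    define y where "y v = (if v \<in> V then x v / s else 0)" for v
    have "0 < s" using subinvariant_sum_pos assms(1) that(1) by (auto simp: s_def)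
    have x0: "0 \<le> x v" if "v \<in> V" for v
      using that \<open>subinvariant V E l x\<close> by (auto simp: subinvariant_def)
    have "x v \<le> s" if "v \<in> V" for v
      unfolding s_def using that assms(1) x0 by (intro member_le_sum) auto
    then have "y \<in> K"
      unfolding K_def y_def using x0 \<open>0 < s\<close> by (auto simp: PiE_def field_simps)
    moreover have "sum y V = 1"
      using \<open>0 < s\<close> unfolding y_def by (simp add: s_def flip: sum_divide_distrib)
    moreover have "l * y v \<le> sum y (E `` {v})" if "v \<in> V" for v
    proof -
      have "sum y (E `` {v}) = sum x (E `` {v}) / s"
        unfolding y_def sum_divide_distrib using assms(3) by (intro sum.cong) auto
      moreover have "l * x v \<le> sum x (E `` {v})"
        using \<open>subinvariant V E l x\<close> that by (auto simp: subinvariant_def)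
      ultimately show ?thesis
        using \<open>0 < s\<close> that by (simp add: y_def divide_right_mono)
    qed
    ultimately show ?thesis
      using subinvariant_le_card[OF assms(1,3) that(1)] that(2)
      by (auto simp: C_def)
  qed
  have "subinvariant V E 1 (\<lambda>_. 1)"
  proof -
    have "1 \<le> real (card (E `` {v}))" if "v \<in> V" for v
    proof -
      have "finite (E `` {v})" using assms(1,3) by (auto intro: finite_subset)
      then have "0 < card (E `` {v})" using assms(4)[OF that] by (simp add: card_gt_0_iff)
      then show ?thesis by linarith
    qed
    then show ?thesis using assms(2) by (auto simp: subinvariant_def)
  qed
  then have "C \<noteq> {}" using normalised[of 1] by auto
  have "continuous_on C (fst :: real \<times> ('a \<Rightarrow> real) \<Rightarrow> real)"
    by (intro continuous_on_fst continuous_on_id)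
  then obtain p where p: "p \<in> C" "\<forall>q\<in>C. fst q \<le> fst p"
    using continuous_attains_sup[OF \<open>compact C\<close> \<open>C \<noteq> {}\<close>] by blast
  show ?thesis
  proof
    show l: "1 \<le> fst p" using p by (auto simp: C_def)
    have "\<exists>v\<in>V. snd p v \<noteq> 0"
    proof (rule ccontr)
      assume "\<not> ?thesis"
      then have "sum (snd p) V = 0" by simp
      then show False using p(1) by (auto simp: C_def)
    qed
    moreover have "0 \<le> snd p v" if "v \<in> V" for v
    proof -
      have "snd p \<in> K" using p(1) by (auto simp: C_def)
      then have "snd p v \<in> {0..1}" using that unfolding K_def by (auto dest!: PiE_mem[of _ _ _ v])
      then show ?thesis by simp
    qed
    ultimately show "subinvariant V E (fst p) (snd p)"
      using p(1) by (auto simp: C_def subinvariant_def)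
    show "l' \<le> fst p" if "subinvariant V E l' x'" for l' x'
    proof (cases "1 \<le> l'")
      case True
      then show ?thesis using normalised[OF that] p(2) by force
    qed (use l in simp)
  qed
qed

lemma rtrancl_enters:
  assumes "(u, v) \<in> E\<^sup>*" "u \<notin> S" "v \<in> S"
  obtains a b where "(a, b) \<in> E" "a \<notin> S" "b \<in> S"
  using assms by (induction rule: rtrancl_induct) blast+

text \<open>Among the vectors for the maximal l, take one with the most strict inequalities, and let
  S be the set of strict vertices. If S were all of V, then l could be increased. If S were nonempty
  and proper, an edge entering S would allow one more strict vertex. Hence S is empty and x is an
  eigenvector.\<close>

lemma perron_eigenvector:
  assumes "finite V" "V \<noteq> {}" "E \<subseteq> V \<times> V" "\<And>v. v \<in> V \<Longrightarrow> E `` {v} \<noteq> {}"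
    and irrefl: "\<And>v. (v, v) \<notin> E"
    and conn: "\<And>u v. u \<in> V \<Longrightarrow> v \<in> V \<Longrightarrow> (u, v) \<in> E\<^sup>*"
  obtains l x where "1 \<le> l" "subinvariant V E l x" "\<And>v. v \<in> V \<Longrightarrow> sum x (E `` {v}) = l * x v"
proof -
  obtain l x0 where l: "1 \<le> l" "subinvariant V E l x0"
    and max: "\<And>l' x'. subinvariant V E l' x' \<Longrightarrow> l' \<le> l"
    using maximal_subinvariant_exists[OF assms(1-4)] by blast
  define S where "S x = {v \<in> V. l * x v < sum x (E `` {v})}" for x
  have "\<forall>y. subinvariant V E l y \<longrightarrow> card (S y) < Suc (card V)"
    using assms(1) by (auto simp: S_def less_Suc_eq_le intro!: card_mono)
  from ex_has_greatest_nat[of "subinvariant V E l" x0 "\<lambda>x. card (S x)", OF l(2) this]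
  obtain x where x: "subinvariant V E l x"
    and mx: "\<And>y. subinvariant V E l y \<Longrightarrow> card (S y) \<le> card (S x)"
    by blast
  have xnn: "0 \<le> x v" if "v \<in> V" for v using x that by (auto simp: subinvariant_def)
  have "S x = {}"
  proof (rule ccontr)
    assume "S x \<noteq> {}"
    then obtain i0 where i0: "i0 \<in> S x" "i0 \<in> V" by (auto simp: S_def)
    have "S x \<noteq> V"
    proof
      assume full: "S x = V"
      \<comment> \<open>The summand 1 keeps the denominator positive where x vanishes; the minimum d
        of g still satisfies d * x v \<le> slack at v.\<close>
      define g where "g v = (sum x (E `` {v}) - l * x v) / (1 + x v)" for v
      define d where "d = Min (g ` V)"
      have "0 < g v" if "v \<in> V" for v
      proof -
        have "v \<in> S x" using that full by simp
        then show ?thesis using xnn[OF that] by (simp add: g_def S_def)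
      qed
      then have "0 < d" using assms(1,2) by (auto simp: d_def)
      have "subinvariant V E (l + d) x"
      proof -
        have "(l + d) * x v \<le> sum x (E `` {v})" if "v \<in> V" for v
        proof -
          have "d \<le> g v" using that assms(1) by (auto simp: d_def)
          then have "d * (1 + x v) \<le> sum x (E `` {v}) - l * x v"
            using xnn[OF that] by (simp add: g_def pos_le_divide_eq)
          then show ?thesis using \<open>0 < d\<close> by (simp add: algebra_simps)
        qed
        then show ?thesis using x by (auto simp: subinvariant_def)
      qed
      from max[OF this] \<open>0 < d\<close> show False by simp
    qed
    then obtain j0 where "j0 \<in> V" "j0 \<notin> S x" by (auto simp: S_def)
    with i0 conn obtain j i where ji: "(j, i) \<in> E" "j \<notin> S x" "i \<in> S x"
      by (meson rtrancl_enters)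
    \<comment> \<open>Raising x at i by a small amount keeps i strict and makes its predecessor j strict as well.\<close>
    define e where "e = (sum x (E `` {i}) - l * x i) / (2 * l)"
    have "0 < e" using ji(3) l(1) by (auto simp: e_def S_def)
    define y where "y = x(i := x i + e)"
    have fin: "finite (E `` {v})" for v using assms(1,3) by (auto intro: finite_subset)
    have sy: "sum y (E `` {v}) = sum x (E `` {v}) + (if (v, i) \<in> E then e else 0)" for v
    proof -
      have "sum y (E `` {v}) = (\<Sum>w\<in>E `` {v}. x w + (if w = i then e else 0))"
        by (intro sum.cong) (auto simp: y_def)
      then show ?thesis using fin[of v] by (simp add: sum.distrib)
    qed
    \<comment> \<open>Raising x at i costs l * e, which is half of the slack at i; without a loop at
      i its successor sum is unchanged.\<close>
    have yi: "l * y i < sum y (E `` {i})"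
    proof -
      have gap: "0 < sum x (E `` {i}) - l * x i" using ji(3) by (simp add: S_def)
      have "l * e = (sum x (E `` {i}) - l * x i) / 2" using l(1) by (simp add: e_def)
      with gap have "l * e < sum x (E `` {i}) - l * x i" by simp
      moreover have "l * y i = l * x i + l * e" by (simp add: y_def algebra_simps)
      moreover have "sum y (E `` {i}) = sum x (E `` {i})" using irrefl sy by simp
      ultimately show ?thesis by simp
    qed
    have xl: "l * x v \<le> sum x (E `` {v})" if "v \<in> V" for v
      using x that by (auto simp: subinvariant_def)
    have "l * y v \<le> sum y (E `` {v})" if "v \<in> V" for v
      using yi sy[of v] xl[OF that] \<open>0 < e\<close> by (cases "v = i") (auto simp: y_def)
    moreover have "0 \<le> y v" if "v \<in> V" for v
      using xnn[OF that] \<open>0 < e\<close> by (auto simp: y_def)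
    moreover have "i \<in> V" "y i \<noteq> 0" 
      using ji(3) xnn[of i] \<open>0 < e\<close> by (auto simp: y_def S_def)
    ultimately have "subinvariant V E l y" by (auto simp: subinvariant_def)
    have "j \<in> V" "j \<noteq> i" using ji assms(3) by auto
    \<comment> \<open>The edge from j to i adds e to the sum at j, where x is unchanged. Strict
      vertices other than i lose nothing, and i is covered by \<open>yi\<close>.\<close>
    have "insert j (S x) \<subseteq> S y"
    proof
      fix v assume v: "v \<in> insert j (S x)"
      show "v \<in> S y"
      proof (cases "v = i")
        case True
        then show ?thesis using yi \<open>i \<in> V\<close> by (simp add: S_def)
      next
        case False
        then show ?thesis
          using v sy[of v] xl[of v] ji(1) \<open>j \<in> V\<close> \<open>0 < e\<close> by (auto simp: S_def y_def)
      qed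
    qed
    then have "card (insert j (S x)) \<le> card (S y)"
      using assms(1) by (intro card_mono) (auto simp: S_def)
    moreover have "card (insert j (S x)) = Suc (card (S x))"
      using ji(2) assms(1) by (auto simp: S_def)
    ultimately show False using mx[OF \<open>subinvariant V E l y\<close>] by simp
  qed
  then have "sum x (E `` {v}) = l * x v" if "v \<in> V" for v
    using that x by (force simp: S_def subinvariant_def)
  then show ?thesis using that l(1) x by blast
qed

text \<open>The value at a successor of a is one term of a nonnegative sum equal to x a, so x does
  not increase along edges. Strong connectivity makes x constant, and the eigenvalue equation then
  counts successors.\<close>

lemma invariant_vector_imp_outdegree_one:
  assumes "finite V" "E \<subseteq> V \<times> V" "subinvariant V E 1 x"
    and conn: "\<And>u v. u \<in> V \<Longrightarrow> v \<in> V \<Longrightarrow> (u, v) \<in> E\<^sup>*"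
    and inv: "\<And>v. v \<in> V \<Longrightarrow> sum x (E `` {v}) = x v"
    and "v \<in> V"
  shows "card (E `` {v}) = 1"
proof -
  have xnn: "0 \<le> x u" if "u \<in> V" for u using assms(3) that by (auto simp: subinvariant_def)
  have fin: "finite (E `` {u})" for u using assms(1,2) by (auto intro: finite_subset)
  have "x b \<le> x a" if "(a, b) \<in> E" for a b
  proof -
    have "x b \<le> sum x (E `` {a})"
      using that assms(2) fin xnn by (intro member_le_sum) auto
    then show ?thesis using inv that assms(2) by auto
  qed
  note step = this
  have "x b \<le> x a" if "(a, b) \<in> E\<^sup>*" for a b
    using that by (induction rule: rtrancl_induct) (auto dest: step)
  then have const: "x u = x v" if "u \<in> V" for u
    using conn that assms(6) by (intro antisym) auto
  then have "x v \<noteq> 0" using assms(3) by (auto simp: subinvariant_def)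
  have "sum x (E `` {v}) = (\<Sum>u\<in>E `` {v}. x v)"
    using const assms(2) by (intro sum.cong) auto
  then have "x v = real (card (E `` {v})) * x v" using inv[OF assms(6)] by simp
  then show ?thesis using \<open>x v \<noteq> 0\<close> by simp
qed

section \<open>Minimal vertex sets in which every vertex has a successor\<close>

lemma unique_successor_subset_exists:
  assumes "finite S" "S \<noteq> {}" "\<And>v. v \<in> S \<Longrightarrow> E `` {v} \<inter> S \<noteq> {}"
  obtains T where "T \<subseteq> S" "T \<noteq> {}" "\<And>v. v \<in> T \<Longrightarrow> card (E `` {v} \<inter> T) = 1"
proof -
  define F where "F = {T \<in> Pow S. T \<noteq> {} \<and> (\<forall>v\<in>T. E `` {v} \<inter> T \<noteq> {})}"
  have "finite F" using assms(1) by (auto simp: F_def)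
  moreover have "S \<in> F" using assms(2,3) by (auto simp: F_def)
  ultimately obtain T where "T \<in> F" and min: "\<And>U. U \<in> F \<Longrightarrow> U \<subseteq> T \<Longrightarrow> T = U"
    using finite_has_minimal[of F] by blast
  then have T: "T \<subseteq> S" "T \<noteq> {}" "\<And>v. v \<in> T \<Longrightarrow> E `` {v} \<inter> T \<noteq> {}" by (auto simp: F_def)
  have "finite T" using T(1) assms(1) by (rule finite_subset)
  have bij: "f ` T = T \<and> inj_on f T" if f: "\<And>v. v \<in> T \<Longrightarrow> f v \<in> E `` {v} \<inter> T" for f
  proof -
    have "f ` T \<subseteq> T" using f by auto
    moreover have "f ` T \<in> F"
    proof -
      have "E `` {w} \<inter> f ` T \<noteq> {}" if "w \<in> f ` T" for w
        using that f by blast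
      then show ?thesis using \<open>f ` T \<subseteq> T\<close> T(1,2) unfolding F_def by blast
    qed
    ultimately have "T = f ` T" by (intro min)
    then show ?thesis using \<open>finite T\<close> by (metis eq_card_imp_inj_on)
  qed
  have "\<forall>v\<in>T. \<exists>w. w \<in> E `` {v} \<inter> T" using T(3) by blast
  from bchoice[OF this] obtain f where f: "\<And>v. v \<in> T \<Longrightarrow> f v \<in> E `` {v} \<inter> T" by blast
  have "card (E `` {v} \<inter> T) = 1" if "v \<in> T" for v
  proof -
    have "a = f v" if a: "a \<in> E `` {v} \<inter> T" for a
    proof (rule ccontr)
      assume "a \<noteq> f v"
      \<comment> \<open>By surjectivity f already takes the value a at some u other than v;
        redirecting v to a makes u and v collide.\<close>
      have "a \<in> f ` T" using bij[OF f] a by auto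
      then obtain u where u: "u \<in> T" "f u = a" by auto
      have "inj_on (f(v := a)) T" by (intro conjunct2[OF bij]) (use f a in auto)
      moreover have "u \<noteq> v" using u \<open>a \<noteq> f v\<close> by auto
      ultimately show False using u \<open>v \<in> T\<close> by (auto dest: inj_onD[of _ _ u v])
    qed
    then have "E `` {v} \<inter> T = {f v}" using f[OF that] by blast
    then show ?thesis by simp
  qed
  with T that show ?thesis by blast
qed

section \<open>Complementarity eigenvectors as functions on the vertices\<close>

text \<open>All terms of the inner product of x with A x - l x are nonnegative, so its vanishing
  means equality at each vertex of the support.\<close>

definition compl_pair :: "'a set \<Rightarrow> ('a \<times> 'a) set \<Rightarrow> real \<Rightarrow> ('a \<Rightarrow> real) \<Rightarrow> bool" where
  "compl_pair V E l x \<longleftrightarrow>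
     subinvariant V E l x \<and> (\<forall>v\<in>V. 0 < x v \<longrightarrow> sum x (E `` {v}) = l * x v)"

lemma compl_pair_zero:
  assumes "finite V" "E \<subseteq> V \<times> V" "v \<in> V" "(v, v) \<notin> E"
  shows "compl_pair V E 0 (\<lambda>u. if u = v then 1 else 0)"
  using assms by (auto simp: compl_pair_def subinvariant_def intro!: sum_nonneg sum.neutral)

lemma compl_pair_nonneg:
  assumes "E \<subseteq> V \<times> V" "compl_pair V E l x"
  shows "0 \<le> l"
proof -
  obtain v where v: "v \<in> V" "x v \<noteq> 0" using assms by (auto simp: compl_pair_def subinvariant_def)
  then have "0 < x v" using assms by (auto simp: compl_pair_def subinvariant_def order.strict_iff_order)
  then have "l * x v = sum x (E `` {v})" using v assms by (auto simp: compl_pair_def subinvariant_def)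
  also have "0 \<le> sum x (E `` {v})" using assms by (intro sum_nonneg) (auto simp: compl_pair_def subinvariant_def)
  finally show ?thesis using \<open>0 < x v\<close> by (simp add: zero_le_mult_iff)
qed

text \<open>The indicator of a set with unique inner successors works: on the set the successor sum
  is exactly 1, and elsewhere the indicator vanishes.\<close>

lemma compl_pair_one:
  assumes "finite V" "E \<subseteq> V \<times> V" "S \<subseteq> V" "S \<noteq> {}" "\<And>v. v \<in> S \<Longrightarrow> E `` {v} \<inter> S \<noteq> {}"
  shows "\<exists>x. compl_pair V E 1 x"
proof -
  have "finite S" using assms(1,3) by (rule finite_subset[rotated])
  then obtain T where T: "T \<subseteq> S" "T \<noteq> {}" "\<And>v. v \<in> T \<Longrightarrow> card (E `` {v} \<inter> T) = 1"
    using unique_successor_subset_exists[of S E] assms(4,5) by blast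
  have fin: "finite (E `` {v})" for v using assms(1,2) by (auto intro: finite_subset)
  have "sum (indicator T) (E `` {v}) = real (card (E `` {v} \<inter> T))" for v
    using fin[of v] by (simp add: indicator_def flip: sum.inter_restrict)
  then have "compl_pair V E 1 (indicator T)"
    using T assms(3) unfolding compl_pair_def subinvariant_def by (auto simp: indicator_def)
  then show ?thesis by blast
qed

lemma compl_pair_support_nonempty:
  assumes "compl_pair V E l x"
  shows "{v \<in> V. 0 < x v} \<noteq> {}"
  using assms by (auto simp: compl_pair_def subinvariant_def order.strict_iff_order)

text \<open>The successor sum at v equals l * x v > 0, so some term is positive. Hence the support
  for a positive eigenvalue contains a cycle.\<close>

lemma compl_pair_support:
  assumes "E \<subseteq> V \<times> V" "compl_pair V E l x" "0 < l" "v \<in> V" "0 < x v"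
  shows "E `` {v} \<inter> {v \<in> V. 0 < x v} \<noteq> {}"
proof
  assume *: "E `` {v} \<inter> {v \<in> V. 0 < x v} = {}"
  have "x w = 0" if "(v, w) \<in> E" for w
  proof -
    have "w \<in> V" using that assms(1) by auto
    moreover have "0 \<le> x w" using assms(2) calculation by (auto simp: compl_pair_def subinvariant_def)
    ultimately show ?thesis using that * by force
  qed
  then have "sum x (E `` {v}) = 0" by auto
  moreover have "sum x (E `` {v}) = l * x v" using assms by (auto simp: compl_pair_def subinvariant_def)
  ultimately show False using assms by simp
qed

text \<open>Successors outside W contribute 0, so the equation on W survives. Outside W the
  inequality compares 0 with a nonnegative sum, and complementarity is vacuous.\<close>

lemma compl_pair_extend:
  assumes "finite V" "E \<subseteq> V \<times> V" "W \<subseteq> V" "subinvariant W (E \<inter> W \<times> W) l x"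
    and eq: "\<And>v. v \<in> W \<Longrightarrow> sum x ((E \<inter> W \<times> W) `` {v}) = l * x v"
  shows "compl_pair V E l (\<lambda>v. if v \<in> W then x v else 0)" (is "compl_pair V E l ?y")
proof -
  have fin: "finite (E `` {v})" for v using assms(1,2) by (auto intro: finite_subset)
  have y0: "0 \<le> ?y v" for v using assms(4) by (auto simp: subinvariant_def)
  have "sum ?y (E `` {v}) = l * x v" if "v \<in> W" for v
  proof -
    have "sum ?y (E `` {v}) = sum x (E `` {v} \<inter> W)" using fin by (simp add: sum.inter_restrict)
    also have "E `` {v} \<inter> W = (E \<inter> W \<times> W) `` {v}" using that by auto
    finally show ?thesis using eq that by simp
  qed
  moreover have "0 \<le> sum ?y (E `` {v})" for v by (intro sum_nonneg y0)
  ultimately show ?thesis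
    using assms(3,4) y0 unfolding compl_pair_def subinvariant_def by auto
qed

section \<open>Terminal strong classes and positive eigenvalues\<close>

text \<open>T is an inclusion-minimal set of the form "everything reachable from v within S". By
  minimality each of its members reaches all of T.\<close>

lemma terminal_class_exists:
  assumes "finite S" "S \<noteq> {}" 
  obtains T where "T \<subseteq> S" "T \<noteq> {}" "R `` T \<inter> S \<subseteq> T"
    "\<And>u v. u \<in> T \<Longrightarrow> v \<in> T \<Longrightarrow> (u, v) \<in> (R \<inter> T \<times> T)\<^sup>*"
proof -
  let ?Q = "R \<inter> S \<times> S"
  define F where "F = (\<lambda>v. ?Q\<^sup>* `` {v}) ` S"
  have "finite F" "F \<noteq> {}" using assms by (auto simp: F_def)
  then obtain T where "T \<in> F" and min: "\<And>U. U \<in> F \<Longrightarrow> U \<subseteq> T \<Longrightarrow> T = U"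
    using finite_has_minimal[of F] by blast
  then obtain v where v: "v \<in> S" "T = ?Q\<^sup>* `` {v}" by (auto simp: F_def)
  have sub: "T \<subseteq> S"
  proof
    fix w assume "w \<in> T"
    then have "(v, w) \<in> ?Q\<^sup>*" using v by simp
    then show "w \<in> S" using v(1) by (induction rule: rtrancl_induct) auto
  qed
  have eq: "?Q\<^sup>* `` {w} = T" if "w \<in> T" for w
  proof -
    have "?Q\<^sup>* `` {w} \<subseteq> T" using that v by auto
    then show ?thesis using min[of "?Q\<^sup>* `` {w}"] that sub by (auto simp: F_def)
  qed
  have closed: "R `` T \<inter> S \<subseteq> T"
  proof
    fix b assume "b \<in> R `` T \<inter> S"
    then obtain a where a: "a \<in> T" "(a, b) \<in> R" "b \<in> S" by auto
    then have "(a, b) \<in> ?Q" using sub by auto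
    then show "b \<in> T" using eq[OF a(1)] by auto
  qed
  \<comment> \<open>Paths in S that start in T never leave T, so they are paths of the relation
    restricted to T.\<close>
  have "(a, b) \<in> (R \<inter> T \<times> T)\<^sup>*" if "(a, b) \<in> ?Q\<^sup>*" "a \<in> T" for a b
    using that
  proof (induction rule: rtrancl_induct)
    case (step b c)
    have "b \<in> T" "c \<in> T" using step eq[OF \<open>a \<in> T\<close>] by (auto intro: rtrancl_into_rtrancl)
    then show ?case using step by (auto intro: rtrancl_into_rtrancl)
  qed simp
  moreover have "(a, b) \<in> ?Q\<^sup>*" if "a \<in> T" "b \<in> T" for a b
    using eq[OF that(1)] that(2) by auto
  ultimately show ?thesis using that[of T] sub closed v by blast
qed

text \<open>The assumption \<open>unique\<close> says that at most one successor of u lies in the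
  strong component of u. On a terminal class T of the support this leaves one successor f v of
  positive weight, so x (f v) = l * x v. As f permutes T, summing over T gives l = 1.\<close>

lemma compl_pair_eq_one:
  assumes "finite V" "E \<subseteq> V \<times> V" "\<And>v. (v, v) \<notin> E"
    and unique: "\<And>u v w. \<lbrakk>(u, v) \<in> E; (u, w) \<in> E; (v, u) \<in> E\<^sup>*; (w, u) \<in> E\<^sup>*\<rbrakk> \<Longrightarrow> v = w"
    and "compl_pair V E l x" "0 < l"
  shows "l = 1"
proof -
  define S where "S = {v \<in> V. 0 < x v}"
  have succ: "E `` {v} \<inter> S \<noteq> {}" if "v \<in> S" for v
    using compl_pair_support[OF assms(2,5,6)] that unfolding S_def by auto
  have "finite S" using assms(1) by (simp add: S_def)
  have "S \<noteq> {}" using compl_pair_support_nonempty[OF assms(5)] by (simp add: S_def)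
  obtain T where T: "T \<subseteq> S" "T \<noteq> {}" "E `` T \<inter> S \<subseteq> T"
    and conn: "\<And>u v. u \<in> T \<Longrightarrow> v \<in> T \<Longrightarrow> (u, v) \<in> (E \<inter> T \<times> T)\<^sup>*"
    using terminal_class_exists[OF \<open>finite S\<close> \<open>S \<noteq> {}\<close>, of E] by metis
  have "finite T" using T(1) \<open>finite S\<close> by (rule finite_subset)
  have "\<forall>v\<in>T. \<exists>w. w \<in> E `` {v} \<inter> S" using succ T(1) by blast
  from bchoice[OF this] obtain f where f: "\<And>v. v \<in> T \<Longrightarrow> f v \<in> E `` {v} \<inter> S" by blast
  have fT: "f v \<in> T" if "v \<in> T" for v using f[OF that] T(3) that by auto
  have connE: "(u, v) \<in> E\<^sup>*" if "u \<in> T" "v \<in> T" for u v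
    using conn[OF that] rtrancl_mono[of "E \<inter> T \<times> T" E] by auto
  \<comment> \<open>A successor in the support lies in T because T is terminal, hence in the strong
    component of v, where \<open>unique\<close> applies.\<close>
  have only: "w = f v" if "v \<in> T" "(v, w) \<in> E" "w \<in> S" for v w
  proof -
    have "w \<in> T" using that T(3) by auto
    then show ?thesis using unique[of v w "f v"] f fT connE that by auto
  qed
  have eig: "x (f v) = l * x v" if "v \<in> T" for v
  proof -
    have "v \<in> V" "0 < x v" using that T(1) by (auto simp: S_def)
    then have "l * x v = sum x (E `` {v})" using assms(5) by (auto simp: compl_pair_def subinvariant_def)
    also have "\<dots> = sum x {f v}"
    proof (rule sum.mono_neutral_right)
      show "finite (E `` {v})" using assms(1,2) by (auto intro: finite_subset)
      show "{f v} \<subseteq> E `` {v}" using f that by auto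
      show "\<forall>w\<in>E `` {v} - {f v}. x w = 0"
      proof
        fix w assume w: "w \<in> E `` {v} - {f v}"
        then have "w \<in> V" "w \<notin> S" using only that assms(2) by auto
        moreover have "0 \<le> x w" using \<open>w \<in> V\<close> assms(5) by (auto simp: compl_pair_def subinvariant_def)
        ultimately show "x w = 0" by (auto simp: S_def)
      qed
    qed
    finally show ?thesis by simp
  qed
  have "f ` T = T"
  proof
    show "T \<subseteq> f ` T"
    proof
      fix w assume w: "w \<in> T"
      \<comment> \<open>The path inside T from f w to w is therefore nonempty; the tail of its last
        edge is mapped to w by f.\<close>
      have "f w \<noteq> w" using f[OF w] assms(3) by auto
      with conn[OF fT[OF w] w] obtain u where "(u, w) \<in> E \<inter> T \<times> T"
        by (metis rtranclE)
      then show "w \<in> f ` T" using only T(1) by blast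
    qed
  qed (use fT in auto)
  then have "bij_betw f T T" using \<open>finite T\<close> by (simp add: bij_betw_def eq_card_imp_inj_on)
  then have "sum x T = (\<Sum>v\<in>T. x (f v))" by (simp add: sum.reindex_bij_betw)
  also have "\<dots> = l * sum x T" using eig by (simp add: sum_distrib_left)
  finally have "sum x T = l * sum x T" .
  moreover have "0 < sum x T" using T \<open>finite T\<close> by (intro sum_pos) (auto simp: S_def)
  ultimately show ?thesis by simp
qed

section \<open>Directed cycles and successor-closed vertex sets\<close>

lemma (in pre_digraph) awalk_verts_eq_Cons_heads:
  "cas u p v \<Longrightarrow> awalk_verts u p = u # map (head G) p"
  by (induction p arbitrary: u) auto

lemma (in pre_digraph) awalk_verts_eq_tails_snoc:
  "cas u p v \<Longrightarrow> awalk_verts u p = map (tail G) p @ [v]"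
  by (induction p arbitrary: u) auto

text \<open>Reading off the visited vertices by tails and by heads shows that the heads are the
  tails rotated by one place.\<close>

lemma (in pre_digraph) closed_awalk_tails_eq_heads:
  assumes "awalk u p u" "p \<noteq> []"
  shows "tail G ` set p = head G ` set p"
proof -
  have cas: "cas u p u" using assms(1) by (simp add: awalk_def)
  have "map (tail G) p @ [u] = u # map (head G) p"
    using awalk_verts_eq_Cons_heads[OF cas] awalk_verts_eq_tails_snoc[OF cas] by simp
  then have e: "rotate1 (map (tail G) p) = map (head G) p"
    using assms(2) by (cases p) auto
  have "set (rotate1 (map (tail G) p)) = set (map (tail G) p)" by simp
  then show ?thesis unfolding e by simp
qed

text \<open>The distinctness in \<open>cycle\<close> concerns the list of heads. Heads and tails
  have the same set of values, so injectivity passes to the tails by counting.\<close>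

lemma (in pre_digraph) cycleD:
  assumes "cycle p"
  shows "tail G ` set p = head G ` set p" "inj_on (tail G) (set p)" "set p \<subseteq> arcs G" "p \<noteq> []"
proof -
  obtain u where u: "awalk u p u" "distinct (tl (awalk_verts u p))" "p \<noteq> []"
    using assms by (auto simp: cycle_def)
  show eq: "tail G ` set p = head G ` set p" using closed_awalk_tails_eq_heads u by blast
  have "cas u p u" using u(1) by (simp add: awalk_def)
  then have d: "distinct (map (head G) p)" using u(2) awalk_verts_eq_Cons_heads by force
  then have "card (head G ` set p) = card (set p)" by (simp add: distinct_map card_image)
  then show "inj_on (tail G) (set p)" unfolding eq[symmetric] by (simp add: eq_card_imp_inj_on)
  show "set p \<subseteq> arcs G" using u(1) by (simp add: awalk_def)
  show "p \<noteq> []" by fact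
qed

text \<open>Without cycles the converse arc relation on the finite set S is well-founded, and a
  minimal element of S would have no successor in S.\<close>

lemma (in wf_digraph) cycle_exists_if_successors:
  assumes "finite S" "S \<noteq> {}" "\<And>v. v \<in> S \<Longrightarrow> arcs_ends G `` {v} \<inter> S \<noteq> {}"
  shows "\<exists>p. cycle p"
proof (rule ccontr)
  assume no: "\<not> (\<exists>p. cycle p)"
  have "\<not> v \<rightarrow>\<^sup>+ v" for v
    using no closed_w_imp_cycle unfolding closed_w_def reachable1_awalk by fastforce
  then have "acyclic (arcs_ends G)" by (simp add: acyclic_def)
  then have "acyclic (arcs_ends G \<inter> S \<times> S)" by (rule acyclic_subset) auto
  moreover have "finite (arcs_ends G \<inter> S \<times> S)" using assms(1) by simp
  ultimately have "wf ((arcs_ends G \<inter> S \<times> S)\<inverse>)" by (simp add: finite_acyclic_wf_converse)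
  then obtain z where "z \<in> S" "\<And>y. (y, z) \<in> (arcs_ends G \<inter> S \<times> S)\<inverse> \<Longrightarrow> y \<notin> S"
    using assms(2) by (metis all_not_in_conv wfE_min)
  then show False using assms(3) by blast
qed

text \<open>Brings acyclicity into the form that supports of eigenvectors satisfy and that
  \<open>compl_pair_one\<close> consumes. The tails of a cycle are such a set S, as they are also
  its heads.\<close>

lemma (in wf_digraph) acyclic_digraph_iff:
  assumes "finite (verts G)"
  shows "acyclic_digraph G \<longleftrightarrow>
    \<not> (\<exists>S \<subseteq> verts G. S \<noteq> {} \<and> (\<forall>v\<in>S. arcs_ends G `` {v} \<inter> S \<noteq> {}))"
proof -
  have "\<exists>S \<subseteq> verts G. S \<noteq> {} \<and> (\<forall>v\<in>S. arcs_ends G `` {v} \<inter> S \<noteq> {})" if "cycle p" for p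
  proof (intro exI conjI ballI)
    note c = cycleD[OF that]
    show "tail G ` set p \<subseteq> verts G" using c(3) by auto
    show "tail G ` set p \<noteq> {}" using c(4) by simp
    fix v assume "v \<in> tail G ` set p"
    then obtain e where e: "e \<in> set p" "v = tail G e" by auto
    then have "(v, head G e) \<in> arcs_ends G" using c(3) by (auto simp: arcs_ends_conv)
    moreover have "head G e \<in> tail G ` set p" unfolding c(1) using e by simp
    ultimately show "arcs_ends G `` {v} \<inter> tail G ` set p \<noteq> {}" by blast
  qed
  moreover have "\<exists>p. cycle p"
    if "S \<subseteq> verts G" "S \<noteq> {}" "\<forall>v\<in>S. arcs_ends G `` {v} \<inter> S \<noteq> {}" for S
    using cycle_exists_if_successors[of S] that assms finite_subset by blast
  ultimately show ?thesis unfolding acyclic_digraph_def by blast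
qed

lemma directed_cycle_inj_on_tail:
  assumes "is_directed_cycle H"
  shows "inj_on (tail H) (arcs H)"
  using assms pre_digraph.cycleD(2) unfolding is_directed_cycle_def by metis

text \<open>With at most one arc out of each vertex, a cycle cannot be left. By strong connectivity
  it visits every vertex, and so it uses every arc.\<close>

lemma (in wf_digraph) is_directed_cycleI:
  assumes "finite (verts G)" "strongly_connected G" "inj_on (tail G) (arcs G)"
    and succ: "\<And>v. v \<in> verts G \<Longrightarrow> arcs_ends G `` {v} \<noteq> {}"
  shows "is_directed_cycle G"
proof -
  have "arcs_ends G `` {v} \<inter> verts G \<noteq> {}" if "v \<in> verts G" for v
    using succ[OF that] adj_in_verts by blast
  moreover have "verts G \<noteq> {}" using assms(2) by (simp add: strongly_connected_def)
  ultimately obtain p where "cycle p" using cycle_exists_if_successors assms(1) by blast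
  note c = cycleD[OF this]
  have arc: "e \<in> set p" if e: "e \<in> arcs G" "tail G e \<in> tail G ` set p" for e
  proof -
    obtain e' where "e' \<in> set p" "tail G e = tail G e'" using e(2) by auto
    then show ?thesis using inj_onD[OF assms(3), of e e'] e(1) c(3) by auto
  qed
  obtain v where v: "v \<in> tail G ` set p" using c(4) by (cases p) auto
  have "w \<in> tail G ` set p" if "v \<rightarrow>\<^sup>* w" for w
    using that
  proof (induction rule: reachable_induct)
    case (step x y)
    then obtain e where "e \<in> arcs G" "tail G e = x" "head G e = y" by auto
    then show ?case using arc[of e] step unfolding c(1) by auto
  qed (use v in simp)
  moreover have "v \<in> verts G" using v c(3) by auto
  ultimately have "verts G \<subseteq> tail G ` set p" using assms(2) by (auto simp: strongly_connected_def)
  then have "verts G = tail G ` set p" using c(3) by auto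
  moreover have "arcs G = set p"
    using arc c(3) \<open>verts G \<subseteq> tail G ` set p\<close> tail_in_verts by blast
  ultimately show ?thesis using \<open>cycle p\<close> unfolding is_directed_cycle_def by blast
qed

lemma induced_subgraph_arcs_ends:
  assumes "induced_subgraph H G"
  shows "arcs_ends H = arcs_ends G \<inter> verts H \<times> verts H"
proof -
  have a: "arcs H = {e \<in> arcs G. tail G e \<in> verts H \<and> head G e \<in> verts H}" 
    and "compatible G H" using assms by (auto simp: induced_subgraph_def subgraph_def)
  then have "tail H = tail G" "head H = head G" by (auto simp: compatible_def)
  then show ?thesis using a by (auto simp: arcs_ends_conv)
qed

section \<open>Translation from matrices to functions on the vertices\<close>

text \<open>The numbering is a bijection that carries vectors to functions, and the conditions are
  matched one by one. As the right-hand side does not mention \<open>vs\<close>, the spectrum is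
  independent of the numbering.\<close>

lemma mem_digraph_spectrum_iff:
  assumes "wf_digraph D" "distinct vs" "set vs = verts D"
  shows "l \<in> digraph_spectrum D vs \<longleftrightarrow> (\<exists>x. compl_pair (verts D) (arcs_ends D) l x)"
proof -
  let ?n = "length vs"
  let ?A = "adjacency_matrix D vs"
  let ?E = "arcs_ends D"
  have bij: "bij_betw (nth vs) {..<?n} (verts D)"
    using assms by (simp add: bij_betw_nth)
  have fin: "finite (verts D)" by (simp flip: assms(3))
  have E: "?E \<subseteq> verts D \<times> verts D" using wf_digraph.adj_in_verts[OF assms(1)] by auto
  have dim[simp]: "dim_row ?A = ?n" "dim_col ?A = ?n" by (auto simp: adjacency_matrix_def)
  have mult: "(?A *\<^sub>v vec ?n (\<lambda>i. x (vs ! i))) $ i = sum x (?E `` {vs ! i})"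
    if "i < ?n" for i and x :: "_ \<Rightarrow> real"
  proof -
    have "(?A *\<^sub>v vec ?n (\<lambda>i. x (vs ! i))) $ i =
        (\<Sum>j\<in>{..<?n}. if vs ! j \<in> ?E `` {vs ! i} then x (vs ! j) else 0)"
      using that by (auto simp: adjacency_matrix_def scalar_prod_def lessThan_atLeast0
          if_distrib[where f="\<lambda>a. a * _"] intro!: sum.cong)
    also have "\<dots> = (\<Sum>w\<in>verts D. if w \<in> ?E `` {vs ! i} then x w else 0)"
      by (rule sum.reindex_bij_betw[OF bij])
    also have "\<dots> = sum x (verts D \<inter> ?E `` {vs ! i})"
      using fin by (simp add: sum.inter_restrict)
    also have "verts D \<inter> ?E `` {vs ! i} = ?E `` {vs ! i}" using E by auto
    finally show ?thesis .
  qed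
  have key: "x \<in> carrier_vec ?n \<Longrightarrow> x = vec ?n (\<lambda>i. y (vs ! i)) \<Longrightarrow>
      (x \<noteq> 0\<^sub>v ?n \<and> 0\<^sub>v ?n \<le> x \<and> l \<cdot>\<^sub>v x \<le> ?A *\<^sub>v x \<and> x \<bullet> (?A *\<^sub>v x - l \<cdot>\<^sub>v x) = 0)
      \<longleftrightarrow> compl_pair (verts D) ?E l y" for x y
  proof -
    assume x: "x = vec ?n (\<lambda>i. y (vs ! i))"
    have all: "(\<forall>v\<in>verts D. P v) \<longleftrightarrow> (\<forall>i<?n. P (vs ! i))" for P
      using assms(3) by (metis all_set_conv_all_nth)
    have "x \<noteq> 0\<^sub>v ?n \<longleftrightarrow> (\<exists>v\<in>verts D. y v \<noteq> 0)"
    proof -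
      have "x = 0\<^sub>v ?n \<longleftrightarrow> (\<forall>i<?n. y (vs ! i) = 0)" by (auto simp: x vec_eq_iff)
      then show ?thesis using all[of "\<lambda>v. y v = 0"] by blast
    qed
    moreover have "0\<^sub>v ?n \<le> x \<longleftrightarrow> (\<forall>v\<in>verts D. 0 \<le> y v)"
      unfolding all by (simp add: x less_eq_vec_def)
    moreover have "l \<cdot>\<^sub>v x \<le> ?A *\<^sub>v x \<longleftrightarrow> (\<forall>v\<in>verts D. l * y v \<le> sum y (?E `` {v}))"
      unfolding all x less_eq_vec_def by (simp add: mult del: index_mult_mat_vec)
    \<comment> \<open>Given the sign and the inequality conditions, every term of the inner product
      is nonnegative, so it vanishes iff each term does.\<close>
    moreover have "x \<bullet> (?A *\<^sub>v x - l \<cdot>\<^sub>v x) = 0 \<longleftrightarrow>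
        (\<forall>v\<in>verts D. 0 < y v \<longrightarrow> sum y (?E `` {v}) = l * y v)"
      if nn: "\<forall>v\<in>verts D. 0 \<le> y v" and le: "\<forall>v\<in>verts D. l * y v \<le> sum y (?E `` {v})"
    proof -
      have "x \<bullet> (?A *\<^sub>v x - l \<cdot>\<^sub>v x) =
          (\<Sum>i<?n. y (vs ! i) * (sum y (?E `` {vs ! i}) - l * y (vs ! i)))"
        unfolding x scalar_prod_def
        by (auto simp: mult lessThan_atLeast0 simp del: index_mult_mat_vec intro!: sum.cong)
      also have "\<dots> = (\<Sum>v\<in>verts D. y v * (sum y (?E `` {v}) - l * y v))"
        by (rule sum.reindex_bij_betw[OF bij])
      also have "\<dots> = 0 \<longleftrightarrow> (\<forall>v\<in>verts D. y v * (sum y (?E `` {v}) - l * y v) = 0)"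
        using nn le fin by (intro sum_nonneg_eq_0_iff) auto
      also have "\<dots> \<longleftrightarrow> (\<forall>v\<in>verts D. 0 < y v \<longrightarrow> sum y (?E `` {v}) = l * y v)"
        using nn by (auto simp: order.strict_iff_order)
      finally show ?thesis .
    qed
    ultimately show ?thesis unfolding compl_pair_def subinvariant_def by blast
  qed
  show ?thesis
  proof
    assume "l \<in> digraph_spectrum D vs"
    then obtain x where x: "x \<in> carrier_vec ?n" and h: "x \<noteq> 0\<^sub>v ?n \<and> 0\<^sub>v ?n \<le> x \<and>
        l \<cdot>\<^sub>v x \<le> ?A *\<^sub>v x \<and> x \<bullet> (?A *\<^sub>v x - l \<cdot>\<^sub>v x) = 0"
      by (auto simp: digraph_spectrum_def complementarity_spectrum_def complementarity_eigenvalue_def)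
    have "x = vec ?n (\<lambda>i. (x $ (the_inv_into {..<?n} (nth vs) (vs ! i))))"
      using x bij by (intro eq_vecI) (auto simp: bij_betw_def the_inv_into_f_f)
    then show "\<exists>x. compl_pair (verts D) ?E l x"
      using key[OF x, of "\<lambda>v. x $ (the_inv_into {..<?n} (nth vs) v)"] h by blast
  next
    assume "\<exists>x. compl_pair (verts D) ?E l x"
    then obtain y where "compl_pair (verts D) ?E l y" by auto
    then show "l \<in> digraph_spectrum D vs"
      using key[of "vec ?n (\<lambda>i. y (vs ! i))" y]
      unfolding digraph_spectrum_def complementarity_spectrum_def complementarity_eigenvalue_def
      by (auto intro!: bexI[of _ "vec ?n (\<lambda>i. y (vs ! i))"])
  qed
qed

section \<open>Strong components and the spectrum\<close>

text \<open>The Perron eigenvector of H, extended by zero, gives an eigenvalue l \<ge> 1 of the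
  whole digraph. If l were 1, all out-degrees in H would be 1 and H would be a directed
  cycle.\<close>

lemma (in digraph) scc_spectrum_not_zero_one:
  assumes "H \<in> sccs" "\<not> is_directed_cycle H" "\<not> is_single_isolated_vertex H"
  obtains l x where "l \<noteq> 0" "l \<noteq> 1" "compl_pair (verts G) (arcs_ends G) l x"
proof -
  let ?W = "verts H"
  let ?R = "arcs_ends H"
  have ind: "induced_subgraph H G" and sc: "strongly_connected H"
    using assms(1) by (auto simp: sccs_def)
  have sub: "subgraph H G" using ind by (rule induced_imp_subgraph)
  then interpret H: wf_digraph H by (simp add: subgraph_def)
  have "?W \<subseteq> verts G" "arcs H \<subseteq> arcs G" and same: "tail H = tail G" "head H = head G"
    using sub by (auto simp: subgraph_def compatible_def)
  have "finite ?W" using \<open>?W \<subseteq> verts G\<close> finite_verts by (rule finite_subset)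
  have R: "?R = arcs_ends G \<inter> ?W \<times> ?W" using ind by (rule induced_subgraph_arcs_ends)
  have "?R \<subseteq> ?W \<times> ?W" using R by auto
  have "?W \<noteq> {}" using sc by (simp add: strongly_connected_def)
  have conn: "(u, v) \<in> ?R\<^sup>*" if "u \<in> ?W" "v \<in> ?W" for u v
    using sc that by (auto simp: strongly_connected_def intro: reachable_rtranclI)
  have irrefl: "(v, v) \<notin> ?R" for v using adj_not_same R by blast
  \<comment> \<open>Without arcs, strong connectivity would leave a single isolated vertex.\<close>
  have "arcs H \<noteq> {}"
  proof
    assume none: "arcs H = {}"
    then have "?R = {}" by (simp add: arcs_ends_conv)
    then have "u = v" if "u \<in> ?W" "v \<in> ?W" for u v using conn[OF that] by simp
    then have "\<exists>v. ?W = {v}" using \<open>?W \<noteq> {}\<close> by blast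
    then show False using assms(3) none by (simp add: is_single_isolated_vertex_def)
  qed
  then obtain a b where ab: "(a, b) \<in> ?R" by (auto simp: arcs_ends_conv)
  then have "a \<in> ?W" "b \<in> ?W" "a \<noteq> b" using R irrefl by auto
  have succ: "?R `` {v} \<noteq> {}" if "v \<in> ?W" for v
  proof (cases "v = a")
    case False
    then show ?thesis
      using conn[OF that \<open>a \<in> ?W\<close>] by (metis Image_singleton_iff converse_rtranclE empty_iff)
  qed (use ab in auto)
  obtain l x where l: "1 \<le> l" "subinvariant ?W ?R l x"
    and eig: "\<And>v. v \<in> ?W \<Longrightarrow> sum x (?R `` {v}) = l * x v"
    using perron_eigenvector[OF \<open>finite ?W\<close> \<open>?W \<noteq> {}\<close> \<open>?R \<subseteq> ?W \<times> ?W\<close> succ irrefl conn]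
    by blast
  have "l \<noteq> 1"
  proof
    assume "l = 1"
    have card: "card (?R `` {v}) = 1" if "v \<in> ?W" for v
      using invariant_vector_imp_outdegree_one[OF \<open>finite ?W\<close> \<open>?R \<subseteq> ?W \<times> ?W\<close> _ conn _ that] l eig
      unfolding \<open>l = 1\<close> by simp
    \<comment> \<open>The tail determines the head because the successor is unique, and both
      determine the arc because there are no multiple arcs.\<close>
    have "inj_on (tail H) (arcs H)"
    proof (rule inj_onI)
      fix e f assume ef: "e \<in> arcs H" "f \<in> arcs H" "tail H e = tail H f"
      then have "head H e \<in> ?R `` {tail H e}" "head H f \<in> ?R `` {tail H e}"
        by (auto simp: arcs_ends_conv intro: rev_image_eqI)
      moreover obtain w where "?R `` {tail H e} = {w}"
        using card[of "tail H e"] ef(1) by (auto simp: card_1_singleton_iff)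
      ultimately have "head H e = head H f" by simp
      then show "e = f"
        using ef \<open>arcs H \<subseteq> arcs G\<close> no_multi_arcs[of e f] by (auto simp: arc_to_ends_def same)
    qed
    then have "is_directed_cycle H"
      using H.is_directed_cycleI[OF \<open>finite ?W\<close> sc] succ by blast
    with assms(2) show False ..
  qed
  moreover have "l \<noteq> 0" using l by simp
  moreover have "compl_pair (verts G) (arcs_ends G) l (\<lambda>v. if v \<in> ?W then x v else 0)"
    using l eig adj_in_verts \<open>?W \<subseteq> verts G\<close> unfolding R
    by (intro compl_pair_extend) auto
  ultimately show ?thesis using that by blast
qed

text \<open>Supplies the assumption \<open>unique\<close> of \<open>compl_pair_eq_one\<close>. Both
  arcs lie in the component of u, which is then a directed cycle and has one arc out of each
  vertex.\<close>

lemma (in digraph) trivial_sccs_imp_unique_successor: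
  assumes triv: "\<And>H. H \<in> sccs \<Longrightarrow> is_directed_cycle H \<or> is_single_isolated_vertex H"
    and "u \<rightarrow> v" "u \<rightarrow> w" "(v, u) \<in> (arcs_ends G)\<^sup>*" "(w, u) \<in> (arcs_ends G)\<^sup>*"
  shows "v = w"
proof -
  have vs: "u \<in> verts G" "v \<in> verts G" "w \<in> verts G" using assms(2,3) adj_in_verts by auto
  define H where "H = G \<restriction> scc_of u"
  have "H \<in> sccs"
    using in_verts_sccsD_sccs[OF scc_of_in_sccs_verts] vs by (simp add: H_def)
  have mem: "u \<in> scc_of u" "v \<in> scc_of u" "w \<in> scc_of u"
    using assms(2-5) vs by (auto simp: scc_of_def reachable_conv')
  obtain e f where e: "e \<in> arcs G" "tail G e = u" "head G e = v"
    and f: "f \<in> arcs G" "tail G f = u" "head G f = w"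
    using assms(2,3) by (meson reachableE)
  have arcs: "e \<in> arcs H" "f \<in> arcs H" and ends: "tail H = tail G" "head H = head G"
    using e f mem by (auto simp: H_def)
  have "\<not> is_single_isolated_vertex H" using arcs by (auto simp: is_single_isolated_vertex_def)
  then have "inj_on (tail H) (arcs H)"
    using triv[OF \<open>H \<in> sccs\<close>] directed_cycle_inj_on_tail by blast
  moreover have "tail H e = tail H f" using e f ends by simp
  ultimately have "e = f" using arcs by (rule inj_onD)
  then show ?thesis using e f by simp
qed

section \<open>The two characterisations\<close>

theorem theorem5p3:
  fixes D :: "('a, 'b) pre_digraph" and vs :: "'a list"
  assumes "digraph D"
    and "verts D \<noteq> {}"
    and "distinct vs" and "set vs = verts D"
  shows "((digraph_spectrum D vs = {0}) \<longleftrightarrow> (card (digraph_spectrum D vs) = 1)) \<and>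
         ((card (digraph_spectrum D vs) = 1) \<longleftrightarrow> acyclic_digraph D) \<and>
         ((digraph_spectrum D vs = {0, 1}) \<longleftrightarrow> (card (digraph_spectrum D vs) = 2)) \<and>
         ((card (digraph_spectrum D vs) = 2) \<longleftrightarrow>
           (\<not> acyclic_digraph D \<and>
            (\<forall>H \<in> pre_digraph.sccs D. is_directed_cycle H \<or> is_single_isolated_vertex H)))"
proof -
  interpret digraph D by fact
  let ?P = "digraph_spectrum D vs"
  let ?E = "arcs_ends D"
  have E: "?E \<subseteq> verts D \<times> verts D" using adj_in_verts by auto
  have irrefl: "(v, v) \<notin> ?E" for v using adj_not_same by blast
  have mem: "l \<in> ?P \<longleftrightarrow> (\<exists>x. compl_pair (verts D) ?E l x)" for l
    by (rule mem_digraph_spectrum_iff[OF wf_digraph assms(3,4)])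
  \<comment> \<open>A digraph without vertices would have empty spectrum; nonemptiness supplies the
    vertex that carries the point mass.\<close>
  have zero: "0 \<in> ?P"
    using compl_pair_zero[OF finite_verts E _ irrefl] assms(2) unfolding mem by blast
  have acyc: "acyclic_digraph D \<longleftrightarrow>
      \<not> (\<exists>S \<subseteq> verts D. S \<noteq> {} \<and> (\<forall>v\<in>S. ?E `` {v} \<inter> S \<noteq> {}))"
    by (rule acyclic_digraph_iff[OF finite_verts])
  have one: "1 \<in> ?P" if "\<not> acyclic_digraph D"
  proof -
    have "\<exists>S \<subseteq> verts D. S \<noteq> {} \<and> (\<forall>v\<in>S. ?E `` {v} \<inter> S \<noteq> {})"
      using that unfolding acyc by (rule notnotD)
    then obtain S where S: "S \<subseteq> verts D" "S \<noteq> {}" and succ: "\<forall>v\<in>S. ?E `` {v} \<inter> S \<noteq> {}"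
      by (elim exE conjE)
    show ?thesis unfolding mem by (rule compl_pair_one[OF finite_verts E S bspec[OF succ]])
  qed
  have acyclic_zero: "?P = {0}" if "acyclic_digraph D"
  proof -
    have "l = 0" if l: "l \<in> ?P" for l
    proof (rule ccontr)
      assume "l \<noteq> 0"
      obtain x where x: "compl_pair (verts D) ?E l x" using l mem by blast
      then have "0 < l" using compl_pair_nonneg[OF E x] \<open>l \<noteq> 0\<close> by simp
      let ?S = "{v \<in> verts D. 0 < x v}"
      have "\<forall>v\<in>?S. ?E `` {v} \<inter> ?S \<noteq> {}"
        using compl_pair_support[OF E x \<open>0 < l\<close>] by (intro ballI) (elim CollectE conjE)
      moreover have "?S \<noteq> {}" using compl_pair_support_nonempty[OF x] .
      moreover have "?S \<subseteq> verts D" by simp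
      ultimately have "\<exists>S \<subseteq> verts D. S \<noteq> {} \<and> (\<forall>v\<in>S. ?E `` {v} \<inter> S \<noteq> {})"
        by (intro exI[of _ ?S] conjI)
      with \<open>acyclic_digraph D\<close> show False unfolding acyc by (rule notE)
    qed
    then show ?thesis using zero by blast
  qed
  have zero_iff: "?P = {0} \<longleftrightarrow> card ?P = 1"
    using zero by (auto simp: card_1_singleton_iff)
  moreover have acyclic_iff: "?P = {0} \<longleftrightarrow> acyclic_digraph D"
    using acyclic_zero one by fastforce
  moreover have "?P = {0, 1} \<longleftrightarrow> card ?P = 2"
  proof
    \<comment> \<open>Cardinality 2 excludes the acyclic case, so 0 and 1 both occur and leave no
      room for a third value.\<close>
    assume two: "card ?P = 2"
    then have "\<not> acyclic_digraph D" using acyclic_zero by fastforce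
    then show "?P = {0, 1}" using two zero one by (auto simp: card_2_iff)
  qed simp
  moreover have "?P = {0, 1} \<longleftrightarrow> \<not> acyclic_digraph D \<and>
      (\<forall>H \<in> sccs. is_directed_cycle H \<or> is_single_isolated_vertex H)"
  proof
    assume two: "?P = {0, 1}"
    then have "\<not> acyclic_digraph D" using acyclic_zero by fastforce
    moreover have "is_directed_cycle H \<or> is_single_isolated_vertex H" if "H \<in> sccs" for H
    proof (rule ccontr)
      assume "\<not> ?thesis"
      then have "\<not> is_directed_cycle H" "\<not> is_single_isolated_vertex H" by simp_all
      with that obtain l x where l: "l \<noteq> 0" "l \<noteq> 1" and "compl_pair (verts D) ?E l x"
        by (rule scc_spectrum_not_zero_one)
      then have "l \<in> ?P" unfolding mem by (intro exI)
      then show False using l two by simp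
    qed
    ultimately show "\<not> acyclic_digraph D \<and>
      (\<forall>H \<in> sccs. is_directed_cycle H \<or> is_single_isolated_vertex H)" by blast
  next
    assume r: "\<not> acyclic_digraph D \<and>
      (\<forall>H \<in> sccs. is_directed_cycle H \<or> is_single_isolated_vertex H)"
    have "l = 0 \<or> l = 1" if l: "l \<in> ?P" for l
    proof -
      obtain x where x: "compl_pair (verts D) ?E l x" using l mem by blast
      have "l = 1" if "0 < l"
      proof (rule compl_pair_eq_one[OF finite_verts E irrefl _ x that])
        fix u v w
        assume "u \<rightarrow>\<^bsub>D\<^esub> v" "u \<rightarrow>\<^bsub>D\<^esub> w" "(v, u) \<in> ?E\<^sup>*" "(w, u) \<in> ?E\<^sup>*"
        then show "v = w" using trivial_sccs_imp_unique_successor r by blast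
      qed
      then show ?thesis using compl_pair_nonneg[OF E x] by force
    qed
    then show "?P = {0, 1}" using zero one r by blast
  qed
  ultimately show ?thesis by simp
qed

end
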